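(* Let $(X,p)$ be a partial metric space and let $a$ be a fixed positive real number such that $p(\xi,\xi)=a$ for all $\xi\in X$. Let $\mathcal{I}$ be a non-trivial admissible ideal of $\mathbb{N}$. Then a sequence $\{\xi_n\}$ in $X$ is $\mathcal{I}$-statistically bounded if and only if there exists a real number $r>0$ such that $\mathcal{I}\text{-}st\text{-}LIM^{r}\xi_n\ne\emptyset$.
   Context: A partial metric on a non-empty set $X$ is a function $p:X\times X\to[0,\infty)$ such that for all $x,y,z\in X$: (p1) $0\le p(x,x)\le p(x,y)$; (p2) $x=y$ if and only if $p(x,x)=p(x,y)=p(y,y)$; (p3) $p(x,y)=p(y,x)$; (p4) $p(x,y)\le p(x,z)+p(z,y)-p(z,z)$. Then $(X,p)$ is called a partial metric space. An ideal of $\mathbb{N}$ is a family $\mathcal{I}\subset 2^{\mathbb{N}}$ containing $\emptyset$, closed under finite unions and under taking subsets; it is non-trivial if $\mathcal{I}\ne 2^{\mathbb{N}}$ and $\mathcal{I}\neq\{\emptyset\}$, and a non-trivial ideal is admissible if $\{n\}\in\mathcal{I}$ for every $n\in\mathbb{N}$. A sequence $\{\xi_n\}$ in $X$ is $\mathcal{I}$-statistically bounded if for every fixed $u\in X$ there exists a positive real number $M$ such that for every $\delta>0$, $\left\{n\in\mathbb{N}:\frac{1}{n}\left|\{k\le n:p(\xi_k,u)\ge M\}\right|\ge\delta\right\}\in\mathcal{I}$. A sequence $\{\xi_n\}$ in $X$ is rough $\mathcal{I}$-statistically convergent to $\xi\in X$ of roughness degree $r\ge 0$ if for every $\varepsilon>0$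 and $\delta>0$, $\left\{n\in\mathbb{N}:\frac{1}{n}\left|\{k\le n:|p(\xi_k,\xi)-p(\xi,\xi)|\ge r+\varepsilon\}\right|\ge\delta\right\}\in\mathcal{I}$. The set of all such $\xi\in X$ is the rough $\mathcal{I}$-statistical limit set, denoted $\mathcal{I}\text{-}st\text{-}LIM^{r}\xi_n$. *)

theory Defs
  imports Complex_Main "HOL-Library.FuncSet"
begin

(* The positive integers {1..} play the role of the set of natural numbers: ideals live on {1..}
   and a sequence is a function on nat of which only the values at indices \<ge> 1 matter. *)

locale partial_metric_space =
  fixes X :: "'a set" and p :: "'a \<Rightarrow> 'a \<Rightarrow> real"
  assumes nonempty: "X \<noteq> {}"
    and self_nonneg: "x \<in> X \<Longrightarrow> 0 \<le> p x x"
    and self_le: "x \<in> X \<Longrightarrow> y \<in> X \<Longrightarrow> p x x \<le> p x y"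
    and eq_iff: "x \<in> X \<Longrightarrow> y \<in> X \<Longrightarrow> x = y \<longleftrightarrow> p x x = p x y \<and> p x y = p y y"
    and commute: "x \<in> X \<Longrightarrow> y \<in> X \<Longrightarrow> p x y = p y x"
    and triangle: "x \<in> X \<Longrightarrow> y \<in> X \<Longrightarrow> z \<in> X \<Longrightarrow> p x y \<le> p x z + p z y - p z z"

definition ideal_on :: "'b set \<Rightarrow> 'b set set \<Rightarrow> bool" where
  "ideal_on S \<I> \<longleftrightarrow> \<I> \<subseteq> Pow S \<and> {} \<in> \<I> \<and>
     (\<forall>A\<in>\<I>. \<forall>B\<in>\<I>. A \<union> B \<in> \<I>) \<and> (\<forall>A\<in>\<I>. \<forall>B. B \<subseteq> A \<longrightarrow> B \<in> \<I>)"

definition nontrivial_ideal_on :: "'b set \<Rightarrow> 'b set set \<Rightarrow> bool" where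
  "nontrivial_ideal_on S \<I> \<longleftrightarrow> ideal_on S \<I> \<and> \<I> \<noteq> Pow S \<and> \<I> \<noteq> {{}}"

definition admissible_ideal_on :: "'b set \<Rightarrow> 'b set set \<Rightarrow> bool" where
  "admissible_ideal_on S \<I> \<longleftrightarrow> nontrivial_ideal_on S \<I> \<and> (\<forall>n\<in>S. {n} \<in> \<I>)"

definition I_st_bounded ::
  "nat set set \<Rightarrow> 'a set \<Rightarrow> ('a \<Rightarrow> 'a \<Rightarrow> real) \<Rightarrow> (nat \<Rightarrow> 'a) \<Rightarrow> bool" where
  "I_st_bounded \<I> X p \<xi> \<longleftrightarrow>
     (\<forall>u\<in>X. \<exists>M>0. \<forall>\<delta>>0.
        {n\<in>{1..}. 1 / real n * real (card {k\<in>{1..n}. p (\<xi> k) u \<ge> M}) \<ge> \<delta>} \<in> \<I>)"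

(* The roughness degree r is meant to be nonnegative. *)
definition rough_I_st_converges ::
  "nat set set \<Rightarrow> ('a \<Rightarrow> 'a \<Rightarrow> real) \<Rightarrow> real \<Rightarrow> (nat \<Rightarrow> 'a) \<Rightarrow> 'a \<Rightarrow> bool" where
  "rough_I_st_converges \<I> p r \<xi> x \<longleftrightarrow>
     (\<forall>\<epsilon>>0. \<forall>\<delta>>0.
        {n\<in>{1..}. 1 / real n * real (card {k\<in>{1..n}. \<bar>p (\<xi> k) x - p x x\<bar> \<ge> r + \<epsilon>}) \<ge> \<delta>} \<in> \<I>)"

definition I_st_LIM ::
  "nat set set \<Rightarrow> 'a set \<Rightarrow> ('a \<Rightarrow> 'a \<Rightarrow> real) \<Rightarrow> real \<Rightarrow> (nat \<Rightarrow> 'a) \<Rightarrow> 'a set" where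
  "I_st_LIM \<I> X p r \<xi> = {x\<in>X. rough_I_st_converges \<I> p r \<xi> x}"

end

theory Submission
  imports Defs
begin

text \<open>Both notions say that a set of bad indices has \<open>\<I>\<close>-statistical density
  zero, and this passes to smaller sets of indices (\<open>ideal_on_density_mono\<close>). It
  therefore suffices to compare the bad indices one by one. If \<open>M\<close> is a bound for some
  point \<open>u\<close>, then \<open>u\<close> itself is a rough limit of degree \<open>M\<close>:
  all distances to \<open>u\<close> are at least \<open>p u u = a\<close>, so a deviation from
  \<open>a\<close> of at least \<open>M + \<epsilon>\<close> forces a distance above
  \<open>M\<close>. Conversely, if \<open>x\<close> is a rough limit of degree \<open>r\<close>, the
  triangle inequality through \<open>x\<close> moves control of the distances to \<open>x\<close> to
  any other point \<open>u\<close>, at the cost of adding \<open>p x u\<close> to the bound.\<close>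

text \<open>A weaker condition can only increase the counting averages, so the exceptional set for
  \<open>P\<close> lies inside the one for \<open>Q\<close>, and ideals are closed under
  subsets.\<close>

lemma ideal_on_density_mono:
  assumes ideal: "ideal_on S \<I>"
    and imp: "\<And>k. k \<ge> 1 \<Longrightarrow> P k \<Longrightarrow> Q k"
    and Q: "{n\<in>{1..}. 1 / real n * real (card {k\<in>{1..n}. Q k}) \<ge> \<delta>} \<in> \<I>"
  shows "{n\<in>{1..}. 1 / real n * real (card {k\<in>{1..n}. P k}) \<ge> \<delta>} \<in> \<I>"
proof -
  have "1 / real n * real (card {k\<in>{1..n}. P k}) \<le> 1 / real n * real (card {k\<in>{1..n}. Q k})" for n
    by (intro mult_left_mono of_nat_mono card_mono) (auto intro: imp)
  then have "{n\<in>{1..}. 1 / real n * real (card {k\<in>{1..n}. P k}) \<ge> \<delta>}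
      \<subseteq> {n\<in>{1..}. 1 / real n * real (card {k\<in>{1..n}. Q k}) \<ge> \<delta>}"
    by (auto intro: order_trans)
  with ideal Q show ?thesis
    unfolding ideal_on_def by blast
qed

theorem theorem3p5:
  fixes X :: "'a set" and p :: "'a \<Rightarrow> 'a \<Rightarrow> real" and a :: real
    and \<I> :: "nat set set" and \<xi> :: "nat \<Rightarrow> 'a"
  assumes "partial_metric_space X p"
    and "a > 0" and "\<And>x. x \<in> X \<Longrightarrow> p x x = a"
    and "admissible_ideal_on {1..} \<I>"
    and "\<xi> \<in> {1..} \<rightarrow> X"
  shows "I_st_bounded \<I> X p \<xi> \<longleftrightarrow> (\<exists>r>0. I_st_LIM \<I> X p r \<xi> \<noteq> {})"
proof -
  interpret partial_metric_space X p by fact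
  have ideal: "ideal_on {1..} \<I>"
    using assms(4) by (simp add: admissible_ideal_on_def nontrivial_ideal_on_def)
  have \<xi>: "\<xi> k \<in> X" if "k \<ge> 1" for k
    using assms(5) that by auto
  \<comment> \<open>By this bound the absolute value in rough convergence is just
    \<open>p (\<xi> k) x - a\<close>.\<close>
  have ge: "a \<le> p (\<xi> k) x" if "k \<ge> 1" "x \<in> X" for k x
    using self_le[OF \<xi>[OF that(1)] that(2)] assms(3)[OF \<xi>[OF that(1)]] by simp
  show ?thesis
  proof
    assume bounded: "I_st_bounded \<I> X p \<xi>"
    obtain u where u: "u \<in> X"
      using nonempty by blast
    then obtain M where "M > 0" and M: "\<And>\<delta>. \<delta> > 0 \<Longrightarrow>
        {n\<in>{1..}. 1 / real n * real (card {k\<in>{1..n}. p (\<xi> k) u \<ge> M}) \<ge> \<delta>} \<in> \<I>"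
      using bounded unfolding I_st_bounded_def by blast
    have "rough_I_st_converges \<I> p M \<xi> u"
      unfolding rough_I_st_converges_def
    proof (intro allI impI)
      fix \<epsilon> \<delta> :: real
      assume "\<epsilon> > 0" "\<delta> > 0"
      \<comment> \<open>Removing the absolute value gives
        \<open>p (\<xi> k) u \<ge> a + M + \<epsilon>\<close>, which exceeds
        \<open>M\<close>.\<close>
      have "p (\<xi> k) u \<ge> M" if "k \<ge> 1" "\<bar>p (\<xi> k) u - p u u\<bar> \<ge> M + \<epsilon>" for k
        using that ge[OF that(1) u] assms(3)[OF u] \<open>a > 0\<close> \<open>\<epsilon> > 0\<close> by linarith
      then show "{n\<in>{1..}. 1 / real n *
          real (card {k\<in>{1..n}. \<bar>p (\<xi> k) u - p u u\<bar> \<ge> M + \<epsilon>}) \<ge> \<delta>} \<in> \<I>"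
        by (rule ideal_on_density_mono[OF ideal _ M[OF \<open>\<delta> > 0\<close>]])
    qed
    with u \<open>M > 0\<close> show "\<exists>r>0. I_st_LIM \<I> X p r \<xi> \<noteq> {}"
      unfolding I_st_LIM_def by blast
  next
    assume "\<exists>r>0. I_st_LIM \<I> X p r \<xi> \<noteq> {}"
    then obtain r x where "r > 0" and x: "x \<in> X" and conv: "rough_I_st_converges \<I> p r \<xi> x"
      unfolding I_st_LIM_def by blast
    \<comment> \<open>A single tolerance is enough for boundedness; it is fixed as
      \<open>\<epsilon> = 1\<close>.\<close>
    have r: "{n\<in>{1..}. 1 / real n *
        real (card {k\<in>{1..n}. \<bar>p (\<xi> k) x - p x x\<bar> \<ge> r + 1}) \<ge> \<delta>} \<in> \<I>" if "\<delta> > 0" for \<delta>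
      using conv that unfolding rough_I_st_converges_def by (meson zero_less_one)
    show "I_st_bounded \<I> X p \<xi>"
      unfolding I_st_bounded_def
    proof (intro ballI exI conjI allI impI)
      fix u
      assume u: "u \<in> X"
      \<comment> \<open>This fixes the bound for \<open>u\<close>, left schematic by
        \<open>exI\<close>: the threshold \<open>r + 1\<close> at \<open>x\<close> plus the distance
        from \<open>x\<close> to \<open>u\<close>.\<close>
      show "r + 1 + p x u > 0"
        using self_nonneg[OF x] self_le[OF x u] \<open>r > 0\<close> by linarith
      fix \<delta> :: real
      assume "\<delta> > 0"
      \<comment> \<open>The term \<open>- p x x\<close> in the partial metric triangle inequality is
        exactly the one in the deviation:
        \<open>p (\<xi> k) u - p x u \<le> p (\<xi> k) x - p x x\<close>.\<close>
      have "\<bar>p (\<xi> k) x - p x x\<bar> \<ge> r + 1" if "k \<ge> 1" "p (\<xi> k) u \<ge> r + 1 + p x u" for k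
        using that triangle[OF \<xi>[OF that(1)] u x] by linarith
      then show "{n\<in>{1..}. 1 / real n *
          real (card {k\<in>{1..n}. p (\<xi> k) u \<ge> r + 1 + p x u}) \<ge> \<delta>} \<in> \<I>"
        by (rule ideal_on_density_mono[OF ideal _ r[OF \<open>\<delta> > 0\<close>]])
    qed
  qed
qed

end
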